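(* Let $\lambda$ be a positive real number and let $f(z)=z+\sum_{k=2}^{\infty}a_kz^k$ be a function in the class $\mathcal{C}$ of close-to-convex functions on the unit disk. (1) If $\lambda\geq 1$, then $$|\lambda a_4^2-a_7|\leq 16\lambda-7,$$ where equality holds if $f$ is the Koebe function $f(z)=z/(1-z)^2$. (2) If $\frac{8}{13}<\lambda<1$, then $$|\lambda a_4^2-a_7|\leq \frac{\lambda(80-49\lambda)+32(2-\lambda)\sqrt{\lambda(2-\lambda)}}{\lambda(32-25\lambda)}.$$ (3) If $0<\lambda\leq\frac{8}{13}$, then $|\lambda a_4^2-a_7|\leq 7$.
   Context: Let $\mathbb{D}=\{z\in\mathbb{C}:|z|<1\}$. $\mathcal{S}$ is the family of univalent analytic functions in $\mathbb{D}$ of the form $f(z)=z+\sum_{k=2}^{\infty}a_kz^k$. A function $g\in\mathcal{S}$ is starlike if $g(\mathbb{D})$ is starlike with respect to the origin; $\mathcal{S}^*$ denotes the class of all starlike functions in $\mathcal{S}$. An analytic function $f$ in $\mathbb{D}$ of the form $f(z)=z+\sum_{k=2}^{\infty}a_kz^k$ is called close-to-convex if there exist a real number $\theta$ and a function $g\in\mathcal{S}^*$ such that $\mathrm{Re}\left(e^{i\theta}zf'(z)/g(z)\right)>0$ for $z\in\mathbb{D}$. $\mathcal{C}$ denotes the class of all close-to-convex functions. *)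

theory Defs
  imports "HOL-Complex_Analysis.Complex_Analysis"
begin

abbreviation unit_disk :: "complex set" where
  "unit_disk \<equiv> ball 0 1"

text \<open>
  Functions on the unit disk are total functions of type \<open>complex \<Rightarrow> complex\<close>; their values
  outside the disk are irrelevant. Only the coefficients \<open>a k\<close> with \<open>k \<ge> 2\<close> are constrained.
\<close>

definition has_normalized_expansion :: "(complex \<Rightarrow> complex) \<Rightarrow> (nat \<Rightarrow> complex) \<Rightarrow> bool" where
  "has_normalized_expansion f a \<longleftrightarrow>
     (\<forall>z\<in>unit_disk. (\<lambda>k. a (k + 2) * z ^ (k + 2)) sums (f z - z))"

definition normalized_analytic :: "(complex \<Rightarrow> complex) set" where
  "normalized_analytic =
     {f. f analytic_on unit_disk \<and> (\<exists>a. has_normalized_expansion f a)}"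

definition class_S :: "(complex \<Rightarrow> complex) set" where
  "class_S = {f \<in> normalized_analytic. inj_on f unit_disk}"

text \<open>The library predicate \<open>starlike\<close> leaves the centre existentially quantified.\<close>

definition starlike_wrt :: "complex \<Rightarrow> complex set \<Rightarrow> bool" where
  "starlike_wrt c A \<longleftrightarrow> c \<in> A \<and> (\<forall>w\<in>A. closed_segment c w \<subseteq> A)"

definition class_S_star :: "(complex \<Rightarrow> complex) set" where
  "class_S_star = {g \<in> class_S. starlike_wrt 0 (g ` unit_disk)}"

text \<open>
  The quotient \<open>z f'(z) / g(z)\<close> has a removable singularity at the origin, where it extends with
  value 1. Division by zero would give it the value 0 there and make the class empty, hence
  the use of \<open>remove_sings\<close>.
\<close>

definition close_to_convex :: "(complex \<Rightarrow> complex) set" where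
  "close_to_convex =
     {f \<in> normalized_analytic. \<exists>(\<theta>::real). \<exists>g\<in>class_S_star. \<forall>z\<in>unit_disk.
        Re (exp (\<i> * of_real \<theta>) * remove_sings (\<lambda>w. w * deriv f w / g w) z) > 0}"

definition koebe :: "complex \<Rightarrow> complex" where
  "koebe z = z / (1 - z)\<^sup>2"

end

theory Submission
  imports Defs
begin

text \<open>
  Write \<open>z f' = g p\<close> with \<open>g\<close> starlike and \<open>Re (e\<^sup>i\<^sup>\<theta> p) > 0\<close>. Schwarz' lemma applied to
  \<open>g\<^sup>-\<^sup>1 (t g)\<close> gives \<open>Re (z g' / g) \<ge> 0\<close>, and Jack's lemma then gives \<open>Re \<surd>(g / z) \<ge> 1/2\<close>.
  Hence \<open>f'\<close> is a limit of convex combinations of products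
  \<open>(1 - x z) / ((1 - a z) (1 - b z) (1 - w z))\<close> with \<open>x, a, b, w\<close> on the unit circle; a Feynman
  parametrisation of the denominators and the maximum principle reduce these to
  \<open>(1 - x z) / (1 - y z)\<^sup>3\<close> with \<open>x, y\<close> on the unit circle.
  After multiplication by a unimodular constant, the functional is at most
  \<open>\<lambda> (Re a\<^sub>4)\<^sup>2 - Re a\<^sub>7\<close>, which is convex, so it is enough to bound it on these kernels. There it
  becomes a quadratic form in two cosines plus a product of two sines, which is estimated by a
  weighted arithmetic-geometric mean inequality; the weight \<open>t\<close> is chosen so that the remaining
  quadratic form is just semidefinite.
\<close>

unbundle no vec_syntax

section \<open>Closed convex hulls of power series\<close>

text \<open>By Hahn-Banach this is the closed convex hull of \<open>S\<close> for coefficientwise convergence.\<close>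
definition fps_hull :: "complex fps set \<Rightarrow> complex fps set" where
  "fps_hull S = {F. \<forall>N c B. (\<forall>G\<in>S. Re (\<Sum>n\<le>N. c n * G $ n) \<le> B) \<longrightarrow> Re (\<Sum>n\<le>N. c n * F $ n) \<le> B}"

text \<open>The Taylor series of 1 / (1 - y z). For y on the unit circle these are the kernels that
  generate the normalized functions with real part at least 1/2.\<close>

definition geo :: "complex \<Rightarrow> complex fps" where
  "geo y = Abs_fps (\<lambda>n. y ^ n)"

lemma fps_hullD:
  "\<lbrakk>F \<in> fps_hull S; \<And>G. G \<in> S \<Longrightarrow> Re (\<Sum>n\<le>N. c n * G $ n) \<le> B\<rbrakk> \<Longrightarrow> Re (\<Sum>n\<le>N. c n * F $ n) \<le> B"
  by (auto simp: fps_hull_def)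

lemma fps_hullI:
  "(\<And>N c B. (\<And>G. G \<in> S \<Longrightarrow> Re (\<Sum>n\<le>N. c n * G $ n) \<le> B) \<Longrightarrow> Re (\<Sum>n\<le>N. c n * F $ n) \<le> B) \<Longrightarrow> F \<in> fps_hull S"
  by (auto simp: fps_hull_def)

lemma fps_hull_superset: "S \<subseteq> fps_hull S"
  by (auto simp only: fps_hull_def)

lemma fps_hull_trans: "\<lbrakk>F \<in> fps_hull S; S \<subseteq> fps_hull T\<rbrakk> \<Longrightarrow> F \<in> fps_hull T"
  unfolding fps_hull_def by blast

text \<open>Transposes multiplication by \<open>A\<close>: a functional of the first coefficients of
  the product is again such a functional of \<open>F\<close>, so hulls are compatible with
  multiplication.\<close>

lemma sum_coeff_mult:
  fixes A F :: "'a::comm_ring_1 fps"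
  shows "(\<Sum>n\<le>N. c n * (A * F) $ n) = (\<Sum>k\<le>N. (\<Sum>n=k..N. c n * A $ (n - k)) * F $ k)"
proof -
  have "(\<Sum>n\<le>N. c n * (A * F) $ n) = (\<Sum>n\<le>N. \<Sum>k\<le>n. c n * A $ (n - k) * F $ k)"
    by (subst mult.commute[of A]) (simp add: fps_mult_nth sum_distrib_left atLeast0AtMost mult.assoc mult.commute[of "F $ _"])
  also have "\<dots> = (\<Sum>k\<le>N. \<Sum>n=k..N. c n * A $ (n - k) * F $ k)"
    using sum.swap_restrict[of "{..N}" "{..N}" "\<lambda>n k. c n * A $ (n - k) * F $ k" "\<lambda>n k. k \<le> n"]
    by (simp add: atLeastAtMost_def atLeast_def atMost_def Int_def conj_commute cong: conj_cong)
  finally show ?thesis by (simp add: sum_distrib_right)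
qed

lemma fps_hull_mult:
  assumes "F \<in> fps_hull S" shows "A * F \<in> fps_hull ((\<lambda>G. A * G) ` S)"
proof (rule fps_hullI)
  fix N c B assume *: "\<And>G. G \<in> (\<lambda>G. A * G) ` S \<Longrightarrow> Re (\<Sum>n\<le>N. c n * G $ n) \<le> B"
  show "Re (\<Sum>n\<le>N. c n * (A * F) $ n) \<le> B"
    unfolding sum_coeff_mult using assms
    by (rule fps_hullD) (use * in \<open>auto simp flip: sum_coeff_mult\<close>)
qed

text \<open>The fixed summand \<open>A\<close> contributes a constant to each functional and so only
  shifts the bound \<open>B\<close>.\<close>

lemma fps_hull_affine:
  assumes "F \<in> fps_hull S" shows "A + C * F \<in> fps_hull ((\<lambda>G. A + C * G) ` S)"
proof (rule fps_hullI)
  fix N c B assume *: "\<And>G. G \<in> (\<lambda>G. A + C * G) ` S \<Longrightarrow> Re (\<Sum>n\<le>N. c n * G $ n) \<le> B"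
  have "Re (\<Sum>n\<le>N. c n * (C * F) $ n) \<le> B - Re (\<Sum>n\<le>N. c n * A $ n)"
  proof (rule fps_hullD[OF fps_hull_mult[OF assms]])
    fix G assume "G \<in> (*) C ` S"
    then have "A + G \<in> (\<lambda>G. A + C * G) ` S" by auto
    from *[OF this] show "Re (\<Sum>n\<le>N. c n * G $ n) \<le> B - Re (\<Sum>n\<le>N. c n * A $ n)"
      by (simp add: algebra_simps sum.distrib)
  qed
  then show "Re (\<Sum>n\<le>N. c n * (A + C * F) $ n) \<le> B"
    by (simp add: algebra_simps sum.distrib)
qed

lemma geo_mult_one_minus: "geo y * (1 - fps_const y * fps_X) = 1"
proof (rule fps_ext)
  fix n show "(geo y * (1 - fps_const y * fps_X)) $ n = 1 $ n"
    by (cases n) (simp_all add: geo_def right_diff_distrib flip: mult.assoc)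
qed

lemma geo_eq_inverse: "geo y = inverse (1 - fps_const y * fps_X)"
  by (rule fps_inverse_unique[symmetric]) (subst mult.commute, rule geo_mult_one_minus)

section \<open>Coefficientwise differentiation in a real parameter and Feynman
  parametrisation\<close>

definition fps_has_deriv :: "(real \<Rightarrow> complex fps) \<Rightarrow> complex fps \<Rightarrow> real \<Rightarrow> bool" where
  "fps_has_deriv F F' t \<longleftrightarrow> (\<forall>n. ((\<lambda>s. F s $ n) has_vector_derivative F' $ n) (at t))"

lemma fps_has_deriv_mult:
  assumes "fps_has_deriv F F' t" "fps_has_deriv G G' t"
  shows "fps_has_deriv (\<lambda>s. F s * G s) (F' * G t + F t * G') t"
  unfolding fps_has_deriv_def
proof
  fix n
  have "((\<lambda>s. \<Sum>i=0..n. F s $ i * G s $ (n - i)) has_vector_derivative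
          (\<Sum>i=0..n. F t $ i * G' $ (n - i) + F' $ i * G t $ (n - i))) (at t)"
    using assms unfolding fps_has_deriv_def
    by (intro has_vector_derivative_sum has_vector_derivative_mult) auto
  then show "((\<lambda>s. (F s * G s) $ n) has_vector_derivative (F' * G t + F t * G') $ n) (at t)"
    by (simp add: fps_mult_nth sum.distrib add_ac)
qed

lemma fps_has_deriv_const: "fps_has_deriv (\<lambda>_. F) 0 t"
  by (simp add: fps_has_deriv_def)

lemma fps_has_deriv_power:
  assumes "fps_has_deriv F F' t"
  shows "fps_has_deriv (\<lambda>s. F s ^ Suc k) (of_nat (Suc k) * F t ^ k * F') t"
proof (induction k)
  case 0 then show ?case using assms by simp
next
  case (Suc k)
  have "fps_has_deriv (\<lambda>s. F s * F s ^ Suc k)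
     (F' * F t ^ Suc k + F t * (of_nat (Suc k) * F t ^ k * F')) t"
    by (rule fps_has_deriv_mult[OF assms Suc])
  then show ?case by (simp add: algebra_simps)
qed

text \<open>Formally, the derivative of 1 / (1 - z X) in the parameter is z' X / (1 - z X)^2, and
  here z' = a - b.\<close>

lemma fps_has_deriv_geo:
  fixes a b :: complex
  defines "z \<equiv> \<lambda>t::real. of_real t * a + of_real (1 - t) * b"
  shows "fps_has_deriv (\<lambda>s. geo (z s)) (fps_const (a - b) * fps_X * geo (z t) ^ 2) t"
proof -
  have sq: "(geo y ^ 2) $ n = of_nat (Suc n) * y ^ n" for y n
    by (simp add: power2_eq_square fps_mult_nth geo_def flip: power_add)
  have z: "(z has_vector_derivative (a - b)) (at t)"
    unfolding z_def by (auto intro!: derivative_eq_intros simp: has_vector_derivative_def scaleR_conv_of_real algebra_simps)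
  have "((\<lambda>s. z s ^ n) has_vector_derivative (fps_const (a - b) * fps_X * geo (z t) ^ 2) $ n) (at t)" for n
  proof (cases n)
    case (Suc m)
    have "((\<lambda>s. z s ^ n) has_vector_derivative ((a - b) * (of_nat n * z t ^ (n - 1)))) (at t)"
      by (rule field_vector_diff_chain_at[OF z, unfolded o_def]) (auto intro!: derivative_eq_intros)
    moreover have "fps_const (a - b) * fps_X * geo (z t) ^ 2 = fps_const (a - b) * (fps_X * geo (z t) ^ 2)"
      by (simp add: mult.assoc)
    ultimately show ?thesis using Suc by (simp only: fps_mult_left_const_nth) (simp add: sq)
  qed (simp add: mult.assoc)
  then show ?thesis by (simp add: fps_has_deriv_def geo_def[of "z _"])
qed

text \<open>A Feynman parametrisation: with \<open>z t = t a + (1 - t) b\<close>, the product \<open>geo a ^ k * geo b\<close>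
  is the integral of \<open>k t ^ (k - 1) geo (z t) ^ (k + 1)\<close> over \<open>[0, 1]\<close>.\<close>
lemma geo_power_mult_geo_in_hull:
  assumes "norm a \<le> 1" "norm b \<le> 1"
  shows "geo a ^ Suc k * geo b \<in> fps_hull {geo z ^ Suc (Suc k) | z. norm z \<le> 1}"
proof (rule fps_hullI)
  fix N c B assume *: "\<And>G. G \<in> {geo z ^ Suc (Suc k) | z. norm z \<le> 1} \<Longrightarrow> Re (\<Sum>n\<le>N. c n * G $ n) \<le> B"
  define z where "z = (\<lambda>t::real. of_real t * a + of_real (1 - t) * b)"
  define tt where "tt = (\<lambda>t::real. fps_const (of_real t :: complex))"
  \<comment> \<open>An explicit antiderivative of the Feynman integrand \<open>F'\<close>: it
    vanishes at \<open>t = 0\<close> and equals \<open>geo a ^ Suc k * geo b\<close> at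
    \<open>t = 1\<close>.\<close>
  define F where "F = (\<lambda>t. (tt t * geo (z t)) ^ Suc k * geo b)"
  define F' where "F' = (\<lambda>t. of_nat (Suc k) * tt t ^ k * geo (z t) ^ Suc (Suc k))"
  have dtt: "fps_has_deriv tt 1 t" for t
    unfolding fps_has_deriv_def tt_def 
    by (auto intro!: derivative_eq_intros simp: has_vector_derivative_def scaleR_conv_of_real)
  have deriv: "fps_has_deriv F (F' t) t" for t
  proof -
    let ?Z = "geo (z t)"
    let ?D = "1 * ?Z + tt t * (fps_const (a - b) * fps_X * ?Z ^ 2)"
    have "fps_has_deriv F ((of_nat (Suc k) * (tt t * ?Z) ^ k * ?D) * geo b + (tt t * ?Z) ^ Suc k * 0) t"
      unfolding F_def
      by (intro fps_has_deriv_mult fps_has_deriv_power fps_has_deriv_const dtt)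
         (simp only: z_def fps_has_deriv_geo)
    \<comment> \<open>Taking out \<open>?Z ^ 2\<close> leaves the factor 1 - z(t) X + t (a - b) X =
      1 - b X, which cancels \<open>geo b\<close>.\<close>
    moreover have "?D * geo b = ?Z ^ 2"
    proof -
      have "?D * geo b = ?Z * (?Z * (1 - fps_const (z t) * fps_X)) * geo b
          + tt t * (fps_const (a - b) * fps_X * ?Z ^ 2) * geo b"
        by (simp add: distrib_right geo_mult_one_minus)
      also have "\<dots> = ?Z ^ 2 * (geo b * (1 - (fps_const (z t) - tt t * fps_const (a - b)) * fps_X))"
        by (simp add: algebra_simps power2_eq_square)
      also have "fps_const (z t) - tt t * fps_const (a - b) = fps_const b"
        by (simp add: tt_def z_def algebra_simps flip: fps_const_mult fps_const_sub fps_const_add)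
      finally show ?thesis by (simp add: geo_mult_one_minus)
    qed
    moreover have "F' t = of_nat (Suc k) * (tt t * ?Z) ^ k * ?Z ^ 2"
      by (simp only: F'_def power_mult_distrib power_add[symmetric] mult.assoc) simp
    ultimately show ?thesis by (simp only: mult.assoc mult_zero_right add_0_right)
  qed
  define u where "u = (\<lambda>t. Re (\<Sum>n\<le>N. c n * F t $ n))"
  define u' where "u' = (\<lambda>t. Re (\<Sum>n\<le>N. c n * F' t $ n))"
  have du: "(u has_real_derivative u' t) (at t)" for t
  proof -
    have "((\<lambda>t. \<Sum>n\<le>N. c n * F t $ n) has_vector_derivative (\<Sum>n\<le>N. c n * F' t $ n)) (at t)"
      using deriv[of t] unfolding fps_has_deriv_def
      by (intro has_vector_derivative_sum has_vector_derivative_mult_right) auto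
    then show ?thesis unfolding u_def u'_def
      by (rule has_field_derivative_Re)
  qed
  have u'_le: "u' t \<le> real (Suc k) * t ^ k * B" if "0 \<le> t" "t \<le> 1" for t
  proof -
    have "norm (z t) \<le> t * norm a + (1 - t) * norm b"
      unfolding z_def by (rule norm_triangle_le) (use that in \<open>simp add: norm_mult del: of_real_diff\<close>)
    also have "\<dots> \<le> t * 1 + (1 - t) * 1"
      using assms that by (intro add_mono mult_left_mono) auto
    finally have "Re (\<Sum>n\<le>N. c n * (geo (z t) ^ Suc (Suc k)) $ n) \<le> B"
      by (intro *) auto
    moreover have "F' t = fps_const (of_real (real (Suc k) * t ^ k)) * geo (z t) ^ Suc (Suc k)"
      by (simp add: F'_def tt_def fps_of_nat[symmetric] fps_const_power)
    then have "u' t = (real (Suc k) * t ^ k) * Re (\<Sum>n\<le>N. c n * (geo (z t) ^ Suc (Suc k)) $ n)"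
      by (simp only: u'_def fps_mult_left_const_nth mult.left_commute[of "c _" "of_real _"] 
            flip: sum_distrib_left) simp
    ultimately show ?thesis using that by (simp add: mult_left_mono)
  qed
  \<comment> \<open>The weight (k + 1) t^k has mass 1 on [0, 1]; monotonicity of the difference
    takes the place of integrating the bound on \<open>u'\<close>.\<close>
  have "B * 0 ^ Suc k - u 0 \<le> B * 1 ^ Suc k - u 1"
  proof (rule DERIV_nonneg_imp_nondecreasing[where f = "\<lambda>t. B * t ^ Suc k - u t"])
    fix t :: real assume "0 \<le> t" "t \<le> 1"
    then have "0 \<le> B * (real (Suc k) * t ^ k) - u' t" using u'_le by (simp add: mult.commute)
    moreover have "((\<lambda>t. B * t ^ Suc k - u t) has_real_derivative B * (real (Suc k) * t ^ k) - u' t) (at t)"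
      using DERIV_pow[of "Suc k" t UNIV] by (intro DERIV_diff DERIV_cmult du) simp
    ultimately show "\<exists>y. ((\<lambda>t. B * t ^ Suc k - u t) has_real_derivative y) (at t) \<and> 0 \<le> y" by blast
  qed simp
  moreover have "u 0 = 0" by (simp add: u_def F_def tt_def)
  ultimately show "Re (\<Sum>n\<le>N. c n * (geo a ^ Suc k * geo b) $ n) \<le> B"
    by (simp add: u_def F_def tt_def z_def)
qed

section \<open>Functions with real part at least 1/2\<close>

text \<open>Cauchy's formula for the n-th derivative on the circle of radius \<open>r\<close>,
  parametrised by [0, 1] and multiplied by r^n / (2 pi i).\<close>

lemma circle_mean_coeff:
  assumes hol: "h holomorphic_on ball 0 1" and H: "h has_fps_expansion H" and r: "0 < r" "r < 1"
  shows "((\<lambda>t. h (of_real r * cis (2 * pi * t)) * cis (- (2 * pi * t)) ^ n) has_integral H $ n * of_real r ^ n) {0..1}"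
proof -
  let ?e = "\<lambda>t. exp (2 * of_real pi * \<i> * of_real t)"
  have "((\<lambda>u. h u / (u - 0) ^ Suc n) has_contour_integral ((2 * pi * \<i>) / fact n * (deriv ^^ n) h 0)) (circlepath 0 r)"
  proof (rule Cauchy_has_contour_integral_higher_derivative_circlepath)
    show "continuous_on (cball 0 r) h" "h holomorphic_on ball 0 r"
      using r by (auto intro!: holomorphic_on_imp_continuous_on intro: holomorphic_on_subset[OF hol])
  qed (use r in auto)
  then have "((\<lambda>t. h (circlepath 0 r t) / (circlepath 0 r t) ^ Suc n *
      vector_derivative (circlepath 0 r) (at t within {0..1})) has_integral 2 * pi * \<i> * H $ n) {0..1}"
    unfolding has_contour_integral_def by (simp add: fps_nth_fps_expansion[OF H])
  moreover have "h (circlepath 0 r t) / (circlepath 0 r t) ^ Suc n *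
      vector_derivative (circlepath 0 r) (at t within {0..1})
      = h (of_real r * ?e t) / (of_real r * ?e t) ^ Suc n * (2 * pi * \<i> * r * ?e t)"
    if "t \<in> {0..1}" for t
    using that vector_derivative_circlepath01[of t 0 r] by (simp add: circlepath)
  ultimately have "((\<lambda>t. h (of_real r * ?e t) / (of_real r * ?e t) ^ Suc n * (2 * pi * \<i> * r * ?e t))
      has_integral 2 * pi * \<i> * H $ n) {0..1}"
    by (rule has_integral_eq[rotated])
  then have "((\<lambda>t. h (of_real r * ?e t) / (of_real r * ?e t) ^ Suc n * (2 * pi * \<i> * r * ?e t) * (r ^ n / (2 * pi * \<i>)))
      has_integral 2 * pi * \<i> * H $ n * (r ^ n / (2 * pi * \<i>))) {0..1}"
    by (rule has_integral_mult_left)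
  moreover have "h (of_real r * ?e t) / (of_real r * ?e t) ^ Suc n * (2 * pi * \<i> * r * ?e t) * (r ^ n / (2 * pi * \<i>))
     = h (of_real r * cis (2 * pi * t)) * cis (- (2 * pi * t)) ^ n" for t
  proof -
    have e: "?e t = cis (2 * pi * t)" by (simp add: cis_conv_exp mult_ac)
    have c: "cis (- (2 * pi * t)) = inverse (?e t)" by (simp add: e cis_inverse)
    have "h (r * E) / (r * E) ^ Suc n * (2 * pi * \<i> * r * E) * (r ^ n / (2 * pi * \<i>))
        = h (r * E) * inverse E ^ n" if "E \<noteq> 0" for E :: complex
      using that r by (simp add: field_simps)
    from this[of "?e t"] show ?thesis by (simp only: c e[symmetric] exp_not_eq_zero not_False_eq_True)
  qed
  ultimately show ?thesis by (simp add: mult_ac)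
qed

text \<open>The coefficients of \<open>q\<close> are the moments of the probability density \<open>2 Re q - 1\<close> on circles.\<close>
lemma half_plane_in_hull_geo:
  assumes hol: "q holomorphic_on ball 0 1" and Q: "q has_fps_expansion Q" and q0: "q 0 = 1"
    and re: "\<And>z. z \<in> ball 0 1 \<Longrightarrow> Re (q z) \<ge> 1 / 2"
  shows "Q \<in> fps_hull {geo y | y. norm y = 1}"
proof (rule fps_hullI)
  fix N c B assume *: "\<And>G. G \<in> {geo y | y. norm y = 1} \<Longrightarrow> Re (\<Sum>n\<le>N. c n * G $ n) \<le> B"
  define T where "T = (\<lambda>t::real. \<Sum>n\<le>N. c n * cis (- (2 * pi * t)) ^ n)"
  define T' where "T' = (\<lambda>z. \<Sum>n\<le>N. cnj (c n) * z ^ n)"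
  have T_le: "Re (T t) \<le> B" for t
  proof -
    have "geo (cis (- (2 * pi * t))) \<in> {geo y | y. norm y = 1}" by force
    from *[OF this] show ?thesis by (simp add: T_def geo_def)
  qed
  have Q0: "Q $ 0 = 1" using has_fps_expansion_imp_0_eq_fps_nth_0[OF Q] q0 by simp
  have le: "Re (\<Sum>n\<le>N. c n * Q $ n * of_real r ^ n) \<le> B" if r: "0 < r" "r < 1" for r
  proof -
    define z where "z = (\<lambda>t. of_real r * cis (2 * pi * t))"
    have z: "z t \<in> ball 0 1" for t using r by (simp add: z_def norm_mult)
    have I1: "((\<lambda>t. q (z t) * T t) has_integral (\<Sum>n\<le>N. c n * (Q $ n * of_real r ^ n))) {0..1}"
      unfolding T_def z_def sum_distrib_left mult.left_commute[of "q _"]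
      by (intro has_integral_sum has_integral_mult_right circle_mean_coeff hol Q r) auto
    have I2: "((\<lambda>t. 1 * T t) has_integral (\<Sum>n\<le>N. c n * ((1 :: complex fps) $ n * of_real r ^ n))) {0..1}"
      unfolding T_def z_def sum_distrib_left mult.left_commute[of "1 :: complex"]
      by (intro has_integral_sum has_integral_mult_right circle_mean_coeff[where h = "\<lambda>_. 1"] r) auto
    then have I2: "(T has_integral c 0) {0..1}"
      by (simp add: if_distrib[of "\<lambda>x. x * _"] if_distrib[of "\<lambda>x. _ * x"] cong: if_cong)
    \<comment> \<open>The conjugate of \<open>T' (z t / r)\<close> is \<open>T t\<close>, and
      \<open>T'\<close> is a polynomial, so \<open>h\<close> is holomorphic. Its mean value property
      evaluates the integral of \<open>cnj q * T\<close>.\<close>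
    define h where "h = (\<lambda>w. q w * T' (w / of_real r))"
    have holh: "h holomorphic_on ball 0 1" unfolding h_def T'_def
      using r by (intro holomorphic_intros hol) auto
    then have "h has_fps_expansion fps_expansion h 0" by (intro has_fps_expansion_fps_expansion) auto
    from circle_mean_coeff[OF holh this r, of 0] has_fps_expansion_imp_0_eq_fps_nth_0[OF this]
    have "((\<lambda>t. h (z t)) has_integral h 0) {0..1}" by (simp add: z_def)
    then have "((cnj \<circ> (\<lambda>t. h (z t))) has_integral cnj (h 0)) {0..1}"
      by (rule has_integral_linear) (rule bounded_linear_cnj)
    moreover have "T' 0 = cnj (c 0)" by (simp add: T'_def power_0_left if_distrib[of "\<lambda>x. _ * x"] cong: if_cong)
    moreover have "cnj (T' (z t / of_real r)) = T t" for t
      using r by (simp add: T'_def T_def z_def cis_cnj)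
    ultimately have I3: "((\<lambda>t. cnj (q (z t)) * T t) has_integral c 0) {0..1}"
      by (simp add: o_def h_def q0)
    \<comment> \<open>The last two integrals cancel, and the integrand is \<open>T\<close> weighted
      by the nonnegative density 2 Re q - 1.\<close>
    have "((\<lambda>t. q (z t) * T t + cnj (q (z t)) * T t - T t) has_integral
        (\<Sum>n\<le>N. c n * (Q $ n * of_real r ^ n)) + c 0 - c 0) {0..1}"
      by (intro has_integral_add has_integral_diff I1 I2 I3)
    then have R: "((\<lambda>t. Re (q (z t) * T t + cnj (q (z t)) * T t - T t)) has_integral
        Re ((\<Sum>n\<le>N. c n * (Q $ n * of_real r ^ n)))) {0..1}"
      by (auto dest: has_integral_Re)
    have "((\<lambda>t. q (z t)) has_integral 1) {0..1}"
      using circle_mean_coeff[OF hol Q r, of 0] by (simp add: z_def Q0)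
    then have "((\<lambda>t. Re (q (z t))) has_integral 1) {0..1}"
      by (auto dest: has_integral_Re)
    then have "((\<lambda>t. B * (2 * Re (q (z t)) - 1)) has_integral B * (2 * 1 - 1)) {0..1}"
      by (intro has_integral_mult_right has_integral_diff) 
         (use has_integral_const_real[of 1 0 1] in auto)
    then have W: "((\<lambda>t. B * (2 * Re (q (z t)) - 1)) has_integral B) {0..1}" by simp
    have "Re (\<Sum>n\<le>N. c n * (Q $ n * of_real r ^ n)) \<le> B"
    proof (rule has_integral_le[OF R W])
      fix t :: real
      have "Re (q (z t) * T t + cnj (q (z t)) * T t - T t) = (2 * Re (q (z t)) - 1) * Re (T t)"
        by (simp add: algebra_simps)
      also have "\<dots> \<le> (2 * Re (q (z t)) - 1) * B"
        using re[OF z, of t] T_le by (intro mult_left_mono) auto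
      finally show "Re (q (z t) * T t + cnj (q (z t)) * T t - T t) \<le> B * (2 * Re (q (z t)) - 1)"
        by (simp add: mult.commute)
    qed
    then show ?thesis by (simp add: mult.assoc)
  qed
  \<comment> \<open>The bound holds on every circle of radius r < 1; let r tend to 1.\<close>
  have "((\<lambda>r. Re (\<Sum>n\<le>N. c n * Q $ n * of_real r ^ n)) \<longlongrightarrow> Re (\<Sum>n\<le>N. c n * Q $ n * of_real 1 ^ n)) (at_left 1)"
    by (intro tendsto_intros)
  moreover have "eventually (\<lambda>r::real. 0 < r \<and> r < 1) (at_left 1)"
    by (auto simp: eventually_at_left_field intro!: exI[of _ 0])
  then have "eventually (\<lambda>r. Re (\<Sum>n\<le>N. c n * Q $ n * of_real r ^ n) \<le> B) (at_left 1)"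
    by eventually_elim (use le in auto)
  ultimately have "Re (\<Sum>n\<le>N. c n * Q $ n * of_real 1 ^ n) \<le> B"
    by (rule tendsto_upperbound) auto
  then show "Re (\<Sum>n\<le>N. c n * Q $ n) \<le> B" by simp
qed

section \<open>Boundary behaviour: the lemmas of Schwarz and Jack\<close>

lemma Schwarz_Lemma_le:
  assumes hol: "f holomorphic_on ball 0 1" and f0: "f 0 = 0"
    and le: "\<And>z. norm z < 1 \<Longrightarrow> norm (f z) \<le> 1" and z: "norm z < 1"
  shows "norm (f z) \<le> norm z"
proof (rule field_le_mult_one_interval)
  fix r :: real assume r: "0 < r" "r < 1"
  have "norm ((\<lambda>z. of_real r * f z) z) \<le> norm z"
  proof (rule Schwarz_Lemma(1))
    fix w :: complex assume "norm w < 1"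
    with le[of w] r have "r * norm (f w) \<le> r * 1" by (intro mult_left_mono) auto
    also have "\<dots> < 1" using r by simp
    finally show "norm (of_real r * f w) < 1" using r by (simp add: norm_mult)
  qed (auto intro!: holomorphic_intros hol simp: f0 z)
  with r show "r * norm (f z) \<le> norm z" by (simp add: norm_mult)
qed

text \<open>Rescale to \<open>v w = f (a w) / f a\<close>, which has modulus at most 1 on the closed
  disk and \<open>v 1 = 1\<close>. Along the unit circle Re v is maximal at 1, so \<open>D\<close>,
  the derivative there, is real. Along the radius the Schwarz bound |v w| <= |w| forces Re D >=
  1.\<close>

lemma Jack_lemma:
  assumes hol: "f holomorphic_on ball 0 1" and f0: "f 0 = 0"
    and a: "norm a < 1" "f a \<noteq> 0"
    and max: "\<And>z. norm z \<le> norm a \<Longrightarrow> norm (f z) \<le> norm (f a)"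
  shows "\<exists>k\<ge>1. a * deriv f a = of_real k * f a"
proof -
  define v where "v = (\<lambda>w. f (a * w) / f a)"
  have a0: "a \<noteq> 0" using a f0 by auto
  have v_le: "norm (v w) \<le> 1" if "norm w \<le> 1" for w
  proof -
    have "norm (a * w) \<le> norm a * 1" using that by (simp only: norm_mult) (rule mult_left_mono, auto)
    then show ?thesis using max[of "a * w"] a by (simp add: v_def norm_divide divide_le_eq_1)
  qed
  have sub: "(\<lambda>w. a * w) ` ball 0 1 \<subseteq> ball 0 1"
  proof safe
    fix w :: complex assume "w \<in> ball 0 1"
    then have "norm (a * w) \<le> norm a * 1" unfolding norm_mult by (intro mult_left_mono) auto
    with a show "a * w \<in> ball 0 1" by simp
  qed
  have holv: "v holomorphic_on ball 0 1" unfolding v_def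
    using a by (intro holomorphic_intros holomorphic_on_compose_gen[OF _ hol sub, unfolded o_def]) auto
  have v_schwarz: "norm (v w) \<le> norm w" if "norm w < 1" for w
    by (rule Schwarz_Lemma_le[OF holv _ v_le that]) (auto simp: v_def f0)
  define D where "D = a * deriv f a / f a"
  have "(f has_field_derivative deriv f a) (at (a * 1))"
    using holomorphic_derivI[OF hol] a by simp
  from DERIV_chain2[OF this DERIV_cmult_Id] have dv: "(v has_field_derivative D) (at 1)"
    unfolding v_def D_def by (rule DERIV_cdivide[THEN DERIV_cong]) simp
  have v1: "v 1 = 1" using a by (simp add: v_def)
  have path: "((\<lambda>t. Re (v (p t))) has_real_derivative Re (p' * D)) (at 0)"
    if "(p has_vector_derivative p') (at 0)" "p 0 = 1" for p p'
    by (rule has_field_derivative_Re)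
       (use field_vector_diff_chain_at[OF that(1), of v D] dv that(2) in \<open>simp add: o_def\<close>)
  have "Re (\<i> * D) = 0"
  proof (rule DERIV_local_max[OF path[of "\<lambda>t. cis t"] zero_less_one])
    show "\<forall>y. \<bar>0 - y\<bar> < 1 \<longrightarrow> Re (v (cis y)) \<le> Re (v (cis 0))"
      using v_le by (auto simp: v1 intro!: complex_Re_le_cmod[THEN order_trans])
  qed (auto simp: has_vector_derivative_def scaleR_conv_of_real intro!: derivative_eq_intros)
  then have Im: "Im D = 0" by simp
  have "Re D \<ge> 1"
  proof (rule ccontr)
    assume "\<not> Re D \<ge> 1"
    have "((\<lambda>t. Re (v (of_real (1 - t)))) has_real_derivative Re (- 1 * D)) (at 0)"
      by (rule path) (auto intro!: derivative_eq_intros simp: has_vector_derivative_def scaleR_conv_of_real)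
    then have "((\<lambda>t. Re (v (of_real (1 - t))) + t) has_real_derivative Re (- 1 * D) + 1) (at 0)"
      by (intro DERIV_add DERIV_ident)
    from has_real_derivative_pos_inc_right[OF this] \<open>\<not> Re D \<ge> 1\<close>
    obtain d where d: "d > 0" "\<And>h. h > 0 \<Longrightarrow> h < d \<Longrightarrow> 
       Re (v (of_real (1 - 0))) + 0 < Re (v (of_real (1 - (0 + h)))) + (0 + h)" by auto
    define h where "h = min (d / 2) (1 / 2)"
    have h: "0 < h" "h < d" "h < 1" using d(1) by (auto simp: h_def min_def)
    have "Re (v (of_real (1 - h))) \<le> norm (of_real (1 - h) :: complex)"
      using h by (intro order_trans[OF complex_Re_le_cmod v_schwarz]) (simp del: of_real_diff)
    then have "Re (v (of_real (1 - h))) \<le> 1 - h" using h by (simp del: of_real_diff)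
    with d(2)[OF h(1,2)] show False using v1 by simp
  qed
  moreover have "a * deriv f a = of_real (Re D) * f a"
  proof -
    have "of_real (Re D) = D" using Im by (simp add: complex_eq_iff)
    then show ?thesis using a by (simp add: D_def)
  qed
  ultimately show ?thesis by blast
qed

text \<open>Translates between the half plane Re w >= 1/2 and the condition |1 - 1/w| <= 1 to which
  Jack's lemma applies.\<close>

lemma norm_less_norm_diff_1_iff: "norm w < norm (w - 1) \<longleftrightarrow> Re w < 1 / 2"
proof -
  have "(norm (w - 1))\<^sup>2 = (norm w)\<^sup>2 - 2 * Re w + 1"
    unfolding cmod_power2 by (simp add: power2_eq_square algebra_simps)
  moreover have "norm w < norm (w - 1) \<longleftrightarrow> (norm w)\<^sup>2 < (norm (w - 1))\<^sup>2"
    by (meson norm_ge_zero power2_less_imp_less power_strict_mono zero_less_numeral)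
  ultimately show ?thesis by auto
qed

text \<open>If the claim fails, \<open>f = 1 - 1/q\<close> exceeds 1 in modulus, and Jack's lemma at
  a maximum point \<open>a\<close> gives a q'(a) / q(a) = k (q(a) - 1) with k >= 1. Since Re q(a) <
  1/2 there, the real part is below -1/2.\<close>

lemma Re_ge_half_if_log_deriv:
  assumes hol: "q holomorphic_on ball 0 1" and q0: "q 0 = 1"
    and nz: "\<And>z. z \<in> ball 0 1 \<Longrightarrow> q z \<noteq> 0"
    and re: "\<And>z. z \<in> ball 0 1 \<Longrightarrow> Re (z * deriv q z / q z) \<ge> - 1 / 2"
    and z: "z \<in> ball 0 1"
  shows "Re (q z) \<ge> 1 / 2"
proof (rule ccontr)
  assume neg: "\<not> Re (q z) \<ge> 1 / 2"
  define f where "f = (\<lambda>w. 1 - 1 / q w)"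
  have holf: "f holomorphic_on ball 0 1"
    unfolding f_def using hol nz by (intro holomorphic_intros) auto
  have "compact (cball (0 :: complex) (norm z))" "cball 0 (norm z) \<noteq> ({} :: complex set)" by auto
  moreover have "continuous_on (cball 0 (norm z)) (\<lambda>w. norm (f w))"
    using z by (intro continuous_on_norm holomorphic_on_imp_continuous_on holomorphic_on_subset[OF holf]) auto
  ultimately obtain a where a: "a \<in> cball 0 (norm z)" "\<And>w. w \<in> cball 0 (norm z) \<Longrightarrow> norm (f w) \<le> norm (f a)"
    using continuous_attains_sup by metis
  have a1: "a \<in> ball 0 1" using a(1) z by auto
  have "norm (q z) < norm (q z - 1)"
    using neg by (simp add: norm_less_norm_diff_1_iff)
  then have "norm (f z) > 1" using nz[OF z] by (simp add: f_def diff_divide_eq_iff norm_divide)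
  then have fa: "norm (f a) > 1" using a(2)[of z] by auto
  have "\<exists>k\<ge>1. a * deriv f a = of_real k * f a"
  proof (rule Jack_lemma[OF holf])
    show "f 0 = 0" by (simp add: f_def q0)
    show "f a \<noteq> 0" using fa by auto
  qed (use a a1 in auto)
  then obtain k where k: "k \<ge> 1" "a * deriv f a = of_real k * f a" by blast
  have qa: "q a \<noteq> 0" using nz a1 by auto
  have "(f has_field_derivative deriv q a / (q a)\<^sup>2) (at a)"
    unfolding f_def using qa holomorphic_derivI[OF hol _ a1]
    by (auto intro!: derivative_eq_intros simp: power2_eq_square)
  then have "deriv f a = deriv q a / (q a)\<^sup>2" by (rule DERIV_imp_deriv)
  then have "a * deriv q a / q a = q a * (a * deriv f a)"
    using qa by (simp add: power2_eq_square)
  also have "\<dots> = of_real k * (q a - 1)" using k(2) qa by (simp add: f_def field_simps)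
  finally have "Re (of_real k * (q a - 1)) \<ge> - 1 / 2" using re[OF a1] by simp
  then have "k * (Re (q a) - 1) \<ge> - 1 / 2" by simp
  moreover have "Re (q a) < 1 / 2"
    using fa qa by (simp add: f_def diff_divide_eq_iff norm_divide norm_less_norm_diff_1_iff)
  then have "k * (Re (q a) - 1) < k * (- 1 / 2)" using k(1) by (intro mult_strict_left_mono) auto
  ultimately show False using k(1) by simp
qed

section \<open>Starlike and close-to-convex functions\<close>

lemma normalized_expansion_has_fps_expansion:
  assumes "has_normalized_expansion f a"
  shows "f has_fps_expansion Abs_fps (\<lambda>n. if n = 0 then 0 else if n = 1 then 1 else a n)" (is "_ has_fps_expansion ?F")
proof (rule has_fps_expansionI)
  have "(\<lambda>n. ?F $ n * z ^ n) sums f z" if "z \<in> ball 0 1" for z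
  proof -
    have "(\<lambda>n. ?F $ (n + 2) * z ^ (n + 2)) sums (f z - z)"
      using assms that by (simp add: has_normalized_expansion_def)
    then have "(\<lambda>n. ?F $ n * z ^ n) sums (f z - z + (\<Sum>n<2. ?F $ n * z ^ n))"
      by (rule iffD1[OF sums_iff_shift])
    then show ?thesis by (simp add: lessThan_nat_numeral)
  qed
  then show "eventually (\<lambda>z. (\<lambda>n. ?F $ n * z ^ n) sums f z) (nhds 0)"
    by (intro eventually_mono[OF eventually_nhds_in_open[of "ball 0 1"]]) auto
qed

lemma normalized_analyticD:
  assumes "f \<in> normalized_analytic"
  shows "f holomorphic_on ball 0 1" "f 0 = 0" "deriv f 0 = 1"
proof -
  show "f holomorphic_on ball 0 1"
    using assms by (auto simp: normalized_analytic_def analytic_imp_holomorphic)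
  obtain a where "has_normalized_expansion f a"
    using assms by (auto simp: normalized_analytic_def)
  note F = normalized_expansion_has_fps_expansion[OF this]
  show "f 0 = 0" using has_fps_expansion_imp_0_eq_fps_nth_0[OF F] by simp
  show "deriv f 0 = 1" using fps_nth_fps_expansion[OF F, of 1] by simp
qed

text \<open>Starlikeness makes w -> phi(t g(w)), with phi the inverse of g, a self-map of the disk
  fixing 0, so Schwarz gives |phi(t g(z))| <= |z| with equality at t = 1. Hence Re (phi(t g(z)) / z)
  has nonnegative derivative \<open>Re D\<close> at t = 1, and z g'/g is the reciprocal of
  \<open>D\<close>.\<close>

lemma starlike_log_deriv:
  assumes hol: "g holomorphic_on ball 0 1" and inj: "inj_on g (ball 0 1)" and g0: "g 0 = 0"
    and star: "starlike_wrt 0 (g ` ball 0 1)" and z: "z \<in> ball 0 1" "z \<noteq> 0"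
  shows "Re (z * deriv g z / g z) \<ge> 0"
proof -
  obtain \<phi> where hol\<phi>: "\<phi> holomorphic_on g ` ball 0 1"
    and d\<phi>: "\<And>z. z \<in> ball 0 1 \<Longrightarrow> deriv g z * deriv \<phi> (g z) = 1"
    and inv: "\<And>z. z \<in> ball 0 1 \<Longrightarrow> \<phi> (g z) = z"
    using holomorphic_has_inverse[OF hol open_ball inj] by blast
  have opn: "open (g ` ball 0 1)"
    using open_mapping_thm3[OF hol open_ball inj] .
  have scaled: "of_real t * g w \<in> g ` ball 0 1" if "w \<in> ball 0 1" "0 \<le> t" "t \<le> 1" for t :: real and w
  proof -
    have "of_real t * g w \<in> closed_segment 0 (g w)"
      using that by (auto simp: closed_segment_def scaleR_conv_of_real)
    then show ?thesis using star that(1) by (auto simp: starlike_wrt_def)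
  qed
  have le: "norm (\<phi> (of_real t * g z)) \<le> norm z" if t: "0 \<le> t" "t \<le> 1" for t :: real
  proof -
    have "norm ((\<lambda>w. \<phi> (of_real t * g w)) z) \<le> norm z"
    proof (rule Schwarz_Lemma_le)
      show "(\<lambda>w. \<phi> (of_real t * g w)) holomorphic_on ball 0 1"
        using scaled t
        by (intro holomorphic_on_compose_gen[OF _ hol\<phi>, unfolded o_def] holomorphic_intros hol) auto
      show "\<phi> (of_real t * g 0) = 0" using inv[of 0] by (simp add: g0)
      show "norm (\<phi> (of_real t * g w)) \<le> 1" if "norm w < 1" for w
      proof -
        have "of_real t * g w \<in> g ` ball 0 1" using scaled[of w t] t that by simp
        then obtain v where "v \<in> ball 0 1" "of_real t * g w = g v" by blast
        then show ?thesis using inv by auto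
      qed
    qed (use z in auto)
    then show ?thesis by simp
  qed
  define v where "v = (\<lambda>t::real. Re (\<phi> (of_real t * g z) / z))"
  define D where "D = g z * deriv \<phi> (g z) / z"
  have dz: "deriv g z * deriv \<phi> (g z) = 1" using d\<phi> z by simp
  have gz: "g z \<noteq> 0"
    using inj_onD[OF inj, of z 0] z g0 by auto
  have "(v has_real_derivative Re D) (at 1)"
  proof -
    have "(\<phi> has_field_derivative deriv \<phi> (g z)) (at (of_real 1 * g z))"
      using holomorphic_derivI[OF hol\<phi> opn] z by auto
    moreover have "((\<lambda>t::real. of_real t * g z) has_vector_derivative g z) (at 1)"
      by (auto intro!: derivative_eq_intros simp: has_vector_derivative_def scaleR_conv_of_real)
    ultimately have "((\<lambda>t. \<phi> (of_real t * g z)) has_vector_derivative g z * deriv \<phi> (g z)) (at 1)"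
      using field_vector_diff_chain_at[unfolded o_def] by blast
    then have "((\<lambda>t. \<phi> (of_real t * g z) / z) has_vector_derivative D) (at 1)"
      unfolding D_def by (rule has_vector_derivative_divide)
    then show ?thesis unfolding v_def by (rule has_field_derivative_Re)
  qed
  have "Re D \<ge> 0"
  proof (rule ccontr)
    assume "\<not> Re D \<ge> 0"
    then obtain d where d: "d > 0" "\<And>h. h > 0 \<Longrightarrow> h < d \<Longrightarrow> v 1 < v (1 - h)"
      using DERIV_neg_dec_left[OF \<open>(v has_real_derivative Re D) (at 1)\<close>] by auto
    define h where "h = min (d / 2) (1 / 2)"
    have h: "0 < h" "h < d" "h < 1" using d(1) by (auto simp: h_def min_def)
    have "v (1 - h) \<le> norm (\<phi> (of_real (1 - h) * g z) / z)"
      unfolding v_def by (rule complex_Re_le_cmod)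
    also have "\<dots> \<le> 1" using le[of "1 - h"] h z by (simp add: norm_divide divide_le_eq_1)
    finally show False using d(2)[OF h(1,2)] z inv[of z] by (simp add: v_def)
  qed
  moreover have "z * deriv g z / g z = inverse D"
  proof -
    have "deriv \<phi> (g z) = inverse (deriv g z)" using dz by (metis inverse_unique mult.commute)
    then show ?thesis by (simp add: D_def field_simps)
  qed
  ultimately show ?thesis by (simp add: complex_inverse sum_power2_ge_zero)
qed

text \<open>The quotient g / z is zero-free, so it has a holomorphic square root q. Then z g'/g = 1
  + 2 z q'/q turns starlikeness into Re (z q'/q) >= -1/2.\<close>

lemma starlike_sqrt:
  assumes "g \<in> class_S_star"
  obtains q where "q holomorphic_on ball 0 1" "q 0 = 1"
    "\<And>z. z \<in> ball 0 1 \<Longrightarrow> q z \<noteq> 0" "\<And>z. z \<in> ball 0 1 \<Longrightarrow> g z = z * q z ^ 2"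
    "\<And>z. z \<in> ball 0 1 \<Longrightarrow> Re (q z) \<ge> 1 / 2"
proof -
  have norm: "g \<in> normalized_analytic" and inj: "inj_on g (ball 0 1)"
    and star: "starlike_wrt 0 (g ` ball 0 1)"
    using assms by (auto simp: class_S_star_def class_S_def)
  note g = normalized_analyticD[OF norm]
  obtain h where h: "h holomorphic_on ball 0 1" "\<And>z. norm z < 1 \<Longrightarrow> g z = z * h z" "deriv g 0 = h 0"
    using Schwarz3[OF g(1,2)] by blast
  have h_nz: "h z \<noteq> 0" if z: "z \<in> ball 0 1" for z
  proof (cases "z = 0")
    case False
    then have "g z \<noteq> 0" using inj_onD[OF inj, of z 0] z g(2) by auto
    then show ?thesis using h(2)[of z] z by auto
  qed (use h(3) g(3) in auto)
  have "contractible (ball 0 1 :: complex set)" by (intro convex_imp_contractible convex_ball)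
  then obtain p where p: "p holomorphic_on ball 0 1" "\<And>z. z \<in> ball 0 1 \<Longrightarrow> h z = p z ^ 2"
    using contractible_imp_holomorphic_sqrt[OF h(1) _ h_nz] by metis
  \<comment> \<open>The root \<open>p\<close> is determined only up to sign, with \<open>p 0\<close>
    equal to 1 or -1; dividing by it normalizes the value at the origin.\<close>
  define q where "q = (\<lambda>z. p z / p 0)"
  have p0: "p 0 ^ 2 = 1" using p(2)[of 0] h(3) g(3) by simp
  then have p0': "p 0 \<noteq> 0" by auto
  have hq: "h z = q z ^ 2" if "z \<in> ball 0 1" for z
    using p(2)[OF that] p0 by (simp add: q_def power_divide)
  have holq: "q holomorphic_on ball 0 1" unfolding q_def using p0' by (intro holomorphic_intros p) auto
  have q0: "q 0 = 1" using p0' by (simp add: q_def)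
  have q_nz: "q z \<noteq> 0" if "z \<in> ball 0 1" for z using h_nz[OF that] hq[OF that] by auto
  have gq: "g z = z * q z ^ 2" if "z \<in> ball 0 1" for z using h(2)[of z] hq[OF that] that by auto
  have "Re (q z) \<ge> 1 / 2" if "z \<in> ball 0 1" for z
  proof (rule Re_ge_half_if_log_deriv[OF holq q0 q_nz _ that])
    fix z :: complex assume z: "z \<in> ball 0 1"
    show "Re (z * deriv q z / q z) \<ge> - 1 / 2"
    proof (cases "z = 0")
      case False
      have "((\<lambda>z. z * q z ^ 2) has_field_derivative (q z ^ 2 + z * (2 * q z * deriv q z))) (at z)"
        using holomorphic_derivI[OF holq _ z]
        by (auto intro!: derivative_eq_intros simp: algebra_simps)
      then have "(g has_field_derivative (q z ^ 2 + z * (2 * q z * deriv q z))) (at z)"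
        by (rule has_field_derivative_transform_within_open[OF _ open_ball z]) (simp add: gq)
      then have "deriv g z = q z ^ 2 + z * (2 * q z * deriv q z)" by (rule DERIV_imp_deriv)
      then have "z * deriv g z / g z = 1 + 2 * (z * deriv q z / q z)"
        using q_nz[OF z] False by (simp add: gq[OF z] field_simps power2_eq_square)
      with starlike_log_deriv[OF g(1) inj g(2) star z False]
      have "0 \<le> Re (1 + 2 * (z * deriv q z / q z))" by (simp only:)
      moreover have "Re (1 + 2 * w) = 1 + 2 * Re w" for w by simp
      ultimately have "0 \<le> 1 + 2 * Re (z * deriv q z / q z)" by (simp only:)
      then show ?thesis by simp
    qed simp
  qed
  with holq q0 q_nz gq show ?thesis using that by blast
qed

section \<open>Reduction of products of kernels to cubes on the unit circle\<close>

lemma geo_in_hull_circle: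
  assumes "norm a \<le> 1" shows "geo a \<in> fps_hull {geo y | y. norm y = 1}"
\<comment> \<open>For |a| <= 1 the function 1 / (1 - a z) itself has real part at least 1/2, so a
  parameter inside the disk can be traded for parameters on the circle.\<close>
proof (rule half_plane_in_hull_geo)
  have nz: "1 - a * z \<noteq> 0" and re: "Re (1 / (1 - a * z)) \<ge> 1 / 2" if "z \<in> ball 0 1" for z
  proof -
    have n: "norm (a * z) < 1"
      using mult_left_le_one_le[of "norm z" "norm a"] assms that by (simp add: norm_mult)
    then show nz: "1 - a * z \<noteq> 0" by auto
    have "1 / (1 - a * z) - 1 = a * z * (1 / (1 - a * z))" using nz by (simp add: field_simps)
    then have "norm (1 / (1 - a * z) - 1) = norm (a * z) * norm (1 / (1 - a * z))" by (simp only: norm_mult)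
    also have "\<dots> \<le> 1 * norm (1 / (1 - a * z))" using n by (intro mult_right_mono) auto
    finally have "\<not> norm (1 / (1 - a * z)) < norm (1 / (1 - a * z) - 1)" by simp
    then show "Re (1 / (1 - a * z)) \<ge> 1 / 2" by (simp only: norm_less_norm_diff_1_iff)
  qed
  show "(\<lambda>z. 1 / (1 - a * z)) holomorphic_on ball 0 1"
    using nz by (intro holomorphic_intros) auto
  show "Re (1 / (1 - a * z)) \<ge> 1 / 2" if "z \<in> ball 0 1" for z by (rule re[OF that])
  have "(\<lambda>z. inverse (1 - a * z)) has_fps_expansion inverse (1 - fps_const a * fps_X)"
    by (intro fps_expansion_intros) auto
  then show "(\<lambda>z. 1 / (1 - a * z)) has_fps_expansion geo a"
    by (simp add: geo_eq_inverse inverse_eq_divide)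
qed simp

text \<open>The n-th coefficient of \<open>geo y ^ 3\<close> is a constant independent of y times
  y^n, so those constants can be absorbed into the weights of the functional.\<close>

lemma geo_cube_in_hull_circle:
  assumes "norm a \<le> 1" shows "geo a ^ 3 \<in> fps_hull {geo y ^ 3 | y. norm y = 1}"
proof (rule fps_hullI)
  fix N c B assume *: "\<And>G. G \<in> {geo y ^ 3 | y. norm y = 1} \<Longrightarrow> Re (\<Sum>n\<le>N. c n * G $ n) \<le> B"
  have geo3: "(geo y ^ 3) $ n = (geo 1 ^ 3) $ n * geo y $ n" for y n
    by (simp add: geo_def power3_eq_cube fps_mult_nth sum_distrib_right mult.left_commute[of "y ^ _"] mult.assoc flip: power_add)
  show "Re (\<Sum>n\<le>N. c n * (geo a ^ 3) $ n) \<le> B"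
    unfolding geo3[of a] mult.assoc[symmetric]
  proof (rule fps_hullD[OF geo_in_hull_circle[OF assms]])
    fix G assume "G \<in> {geo y | y. norm y = 1}"
    then obtain y where y: "G = geo y" "norm y = 1" by blast
    then have "Re (\<Sum>n\<le>N. c n * (geo y ^ 3) $ n) \<le> B" by (intro *) blast
    then show "Re (\<Sum>n\<le>N. c n * (geo 1 ^ 3) $ n * G $ n) \<le> B"
      unfolding geo3[of y] by (simp only: y mult.assoc)
  qed
qed

text \<open>Two Feynman steps merge the three factors into the cube of one kernel. Its parameter is
  a convex combination and may lie inside the disk, hence the final passage to the circle.\<close>

lemma geo_mult3_in_hull:
  assumes "norm a = 1" "norm b = 1" "norm w = 1"
  shows "geo w * geo a * geo b \<in> fps_hull {geo y ^ 3 | y. norm y = 1}"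
proof -
  have "geo a * geo b \<in> fps_hull {geo z ^ 2 | z. norm z \<le> 1}"
    using geo_power_mult_geo_in_hull[of a b 0] assms by (simp add: numeral_2_eq_2)
  then have "geo w * (geo a * geo b) \<in> fps_hull ((\<lambda>G. geo w * G) ` {geo z ^ 2 | z. norm z \<le> 1})"
    by (rule fps_hull_mult)
  moreover have "(\<lambda>G. geo w * G) ` {geo z ^ 2 | z. norm z \<le> 1} \<subseteq> fps_hull {geo y ^ 3 | y. norm y = 1}"
  proof safe
    fix z :: complex assume z: "norm z \<le> 1"
    have "geo w * geo z ^ 2 \<in> fps_hull {geo z ^ 3 | z. norm z \<le> 1}"
      using geo_power_mult_geo_in_hull[of z w 1] assms z
      by (simp add: numeral_2_eq_2 numeral_3_eq_3 mult_ac)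
    then show "geo w * geo z ^ 2 \<in> fps_hull {geo y ^ 3 | y. norm y = 1}"
      by (rule fps_hull_trans) (auto intro: geo_cube_in_hull_circle)
  qed
  ultimately show ?thesis unfolding mult.assoc by (rule fps_hull_trans)
qed

lemma fps_hull_mult_trans:
  assumes "F \<in> fps_hull S" "\<And>G. G \<in> S \<Longrightarrow> A * G \<in> fps_hull T"
  shows "A * F \<in> fps_hull T"
  using fps_hull_mult[OF assms(1)] assms(2) by (blast intro: fps_hull_trans)

lemma close_to_convex_deriv_in_hull:
  assumes f: "f \<in> close_to_convex" and F: "f has_fps_expansion F"
  shows "fps_deriv F \<in> fps_hull {(1 - fps_const x * fps_X) * geo y ^ 3 | x y. norm x = 1 \<and> norm y = 1}"
    (is "_ \<in> fps_hull ?K")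
proof -
  obtain \<theta> g where g: "g \<in> class_S_star" and fn: "f \<in> normalized_analytic"
    and pos: "\<And>z. z \<in> ball 0 1 \<Longrightarrow> Re (exp (\<i> * of_real \<theta>) * remove_sings (\<lambda>w. w * deriv f w / g w) z) > 0"
    using f unfolding close_to_convex_def by blast
  note f = normalized_analyticD[OF fn]
  obtain q where q: "q holomorphic_on ball 0 1" "q 0 = 1"
    "\<And>z. z \<in> ball 0 1 \<Longrightarrow> q z \<noteq> 0" "\<And>z. z \<in> ball 0 1 \<Longrightarrow> g z = z * q z ^ 2"
    "\<And>z. z \<in> ball 0 1 \<Longrightarrow> Re (q z) \<ge> 1 / 2"
    using starlike_sqrt[OF g] by blast
  define Q where "Q = fps_expansion q 0"
  have Q: "q has_fps_expansion Q"
    unfolding Q_def using q(1) by (intro has_fps_expansion_fps_expansion[of "ball 0 1"]) auto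
  \<comment> \<open>Since g = z q^2, this is the holomorphic extension of z f'/g to the origin,
    where its value is 1.\<close>
  define p where "p = (\<lambda>z. deriv f z / q z ^ 2)"
  have holp: "p holomorphic_on ball 0 1"
    unfolding p_def using q(3) by (intro holomorphic_intros q f) auto
  have rs: "remove_sings (\<lambda>w. w * deriv f w / g w) z = p z" if z: "z \<in> ball 0 1" for z
  proof (rule remove_sings_eqI)
    have "isCont p z" using holp z
      using holomorphic_on_imp_continuous_on continuous_on_interior[of "ball 0 1" p z] by auto
    then have "p \<midarrow>z\<rightarrow> p z" by (simp add: isCont_def)
    moreover have "eventually (\<lambda>w. w \<in> ball 0 1 \<and> w \<noteq> 0) (at z)"
      using eventually_at_in_open'[OF open_ball z] eventually_neq_at_within[of 0 z] by eventually_elim auto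
    then have "eventually (\<lambda>w. w * deriv f w / g w = p w) (at z)"
      by eventually_elim (use q(4) in \<open>auto simp: p_def\<close>)
    ultimately show "(\<lambda>w. w * deriv f w / g w) \<midarrow>z\<rightarrow> p z" by (simp add: tendsto_cong)
  qed
  have p0: "p 0 = 1" by (simp add: p_def q f)
  define e where "e = cis \<theta>"
  have e: "exp (\<i> * of_real \<theta>) = e" "e * cnj e = 1" "norm e = 1"
    by (simp_all add: e_def cis_cnj cis_mult flip: cis_conv_exp)
  have re_p: "Re (e * p z) > 0" if "z \<in> ball 0 1" for z
    using pos[OF that] rs[OF that] e by simp
  have re_e: "Re e > 0" using re_p[of 0] p0 by simp
  have e2: "e + cnj e = of_real (2 * Re e)" by (simp add: complex_eq_iff)
  \<comment> \<open>The affine normalization of \<open>e * p\<close>: it maps Re > 0 into Re > 1/2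
    and takes the value 1 at the origin. Evaluating the hypothesis at 0 has given Re e > 0.\<close>
  define s where "s = (\<lambda>z. (e * p z + cnj e) / of_real (2 * Re e))"
  have s: "s holomorphic_on ball 0 1" "s 0 = 1"
    unfolding s_def using holp re_e e2 by (auto intro!: holomorphic_intros simp: p0)
  have re_s: "Re (s z) \<ge> 1 / 2" if "z \<in> ball 0 1" for z
  proof -
    have "s z = of_real (1 / (2 * Re e)) * (e * p z + cnj e)" by (simp add: s_def)
    then have "Re (s z) = (Re (e * p z) + Re e) / (2 * Re e)"
      by (simp only: times_complex.sel Re_complex_of_real Im_complex_of_real) simp
    also have "\<dots> \<ge> Re e / (2 * Re e)"
      using re_e re_p[OF that] by (intro divide_right_mono) auto
    finally show ?thesis using re_e by simp
  qed
  define S where "S = fps_expansion s 0"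
  have S: "s has_fps_expansion S"
    unfolding S_def using s(1) by (intro has_fps_expansion_fps_expansion[of "ball 0 1"]) auto
  \<comment> \<open>The constant for which p = x + (1 - x) s; it is unimodular, which puts the zero
    of the kernel's numerator on the unit circle.\<close>
  define x where "x = - (cnj e ^ 2)"
  have x: "norm x = 1" using e by (simp add: x_def norm_power)
  have "p z = x + (1 - x) * s z" for z
  proof -
    have "(1 - x) = cnj e * (e + cnj e)"
      using e(2) by (simp add: x_def algebra_simps power2_eq_square)
    then have "(1 - x) * s z = cnj e * (e * p z + cnj e)" using re_e by (simp add: e2 s_def)
    then show ?thesis using e(2) by (simp add: x_def algebra_simps power2_eq_square)
  qed
  moreover have "deriv f z = q z * (q z * p z)" if "z \<in> ball 0 1" for z
    using q(3)[OF that] by (simp add: p_def power2_eq_square)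
  ultimately have df: "deriv f z = q z * (q z * (x + (1 - x) * s z))" if "z \<in> ball 0 1" for z
    using that by simp
  have "eventually (\<lambda>z. z \<in> ball (0 :: complex) 1) (nhds 0)" by (rule eventually_nhds_in_open) auto
  then have "eventually (\<lambda>z. deriv f z = q z * (q z * (x + (1 - x) * s z))) (nhds 0)"
    by eventually_elim (rule df)
  then have "deriv f has_fps_expansion Q * (Q * (fps_const x + fps_const (1 - x) * S))"
    by (rule has_fps_expansion_cong[OF _ refl, THEN iffD2]) (intro fps_expansion_intros Q S)
  with has_fps_expansion_deriv[OF F]
  have "fps_deriv F = Q * (Q * (fps_const x + fps_const (1 - x) * S))"
    by (rule fps_expansion_unique_complex)
  also have "\<dots> = Q * (Q * fps_const x + (Q * fps_const (1 - x)) * S)"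
    by (simp add: algebra_simps)
  also have "\<dots> \<in> fps_hull ?K"
  proof -
    note QH = half_plane_in_hull_geo[OF q(1) Q q(2) q(5)]
    note SH = half_plane_in_hull_geo[OF s(1) S s(2) re_s]
    have kernel: "fps_const x + fps_const (1 - x) * geo w = (1 - fps_const (x * w) * fps_X) * geo w" for w
    proof -
      have "fps_const x + fps_const (1 - x) * geo w
         = fps_const x * (geo w * (1 - fps_const w * fps_X)) + fps_const (1 - x) * geo w"
        by (simp add: geo_mult_one_minus)
      also have "\<dots> = (1 - fps_const (x * w) * fps_X) * geo w"
        by (simp add: algebra_simps flip: fps_const_mult fps_const_sub)
      finally show ?thesis .
    qed
    have "Q * Q * fps_const x + (Q * Q * fps_const (1 - x)) * S \<in> fps_hull
        ((\<lambda>G. Q * Q * fps_const x + (Q * Q * fps_const (1 - x)) * G) ` {geo y | y. norm y = 1})"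
      by (rule fps_hull_affine[OF SH])
    moreover have "(\<lambda>G. Q * Q * fps_const x + (Q * Q * fps_const (1 - x)) * G) ` {geo y | y. norm y = 1} \<subseteq> fps_hull ?K"
    proof safe
      fix w :: complex assume w: "norm w = 1"
      let ?A = "(1 - fps_const (x * w) * fps_X) * geo w"
      have "?A * geo a * geo b \<in> fps_hull ?K" if "norm a = 1" "norm b = 1" for a b
      proof -
        have "(1 - fps_const (x * w) * fps_X) * (geo w * geo a * geo b) \<in> fps_hull ?K"
        proof (rule fps_hull_trans[OF fps_hull_mult[OF geo_mult3_in_hull]])
          show "(*) (1 - fps_const (x * w) * fps_X) ` {geo y ^ 3 |y. norm y = 1} \<subseteq> fps_hull ?K"
            using x w by (force intro: fps_hull_superset[THEN subsetD] simp: norm_mult)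
        qed (use that w in auto)
        then show ?thesis by (simp only: mult.assoc)
      qed
      \<comment> \<open>With \<open>S\<close> already replaced by \<open>geo w\<close>, the two
        factors \<open>Q\<close> are replaced by kernels one after the other.\<close>
      then have "?A * geo a * Q \<in> fps_hull ?K" if "norm a = 1" for a
        using that by (intro fps_hull_mult_trans[OF QH]) auto
      then have "(?A * Q) * geo a \<in> fps_hull ?K" if "norm a = 1" for a
        using that by (simp add: mult_ac)
      then have "(?A * Q) * Q \<in> fps_hull ?K"
        by (intro fps_hull_mult_trans[OF QH]) auto
      then show "Q * Q * fps_const x + (Q * Q * fps_const (1 - x)) * geo w \<in> fps_hull ?K"
        by (simp only: kernel[symmetric]) (simp add: algebra_simps)
    qed
    ultimately show ?thesis by (simp add: algebra_simps fps_hull_trans)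
  qed
  finally show ?thesis .
qed

section \<open>The coefficient functional\<close>

text \<open>For \<open>f' = (1 - x z) / (1 - y z)\<^sup>3\<close> and a unimodular \<open>m\<close>, \<open>P = m y\<^sup>3\<close> and \<open>R = - m x y\<^sup>2\<close> satisfy
  \<open>m a\<^sub>4 = (5 P + 3 R) / 2\<close> and \<open>m\<^sup>2 a\<^sub>7 = 4 P\<^sup>2 + 3 P R\<close>.\<close>
lemma extreme_point_bound:
  fixes lam t :: real and P R :: complex
  assumes lam: "0 < lam" "lam \<le> 1" and t: "t > 0" "9 * lam * t\<^sup>2 + 18 * lam * t \<le> 32 - 25 * lam"
    and unit: "norm P = 1" "norm R = 1"
  shows "lam * (Re ((5 * P + 3 * R) / 2))\<^sup>2 - Re (4 * P\<^sup>2 + 3 * P * R) \<le> 4 + 3 / 2 * (t + 1 / t)"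
proof -
  define p s q r where "p = Re P" "s = Im P" "q = Re R" "r = Im R"
  have s2: "s\<^sup>2 = 1 - p\<^sup>2" and r2: "r\<^sup>2 = 1 - q\<^sup>2"
    using unit cmod_power2[of P] cmod_power2[of R] by (simp_all add: p_s_q_r_def)
  have "0 \<le> (t * s - r)\<^sup>2 / t" using t by simp
  moreover have "(t * s - r)\<^sup>2 / t = t * s\<^sup>2 + r\<^sup>2 / t - 2 * (s * r)"
    using t(1) by (simp add: power2_eq_square field_simps)
  ultimately have sr: "2 * (s * r) \<le> t * (1 - p\<^sup>2) + (1 - q\<^sup>2) / t"
    unfolding s2[symmetric] r2[symmetric] by linarith
  \<comment> \<open>Coefficients of the quadratic form in the cosines \<open>p\<close>,
    \<open>q\<close> that remains once the product of sines is estimated by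
    \<open>sr\<close>.\<close>
  define a b c where "a = 8 + 3 / 2 * t - 25 / 4 * lam" "b = 3 / 2 - 15 / 4 * lam" "c = 3 / 2 / t - 9 / 4 * lam"
  have a: "a > 0" using lam t by (simp add: a_b_c_def)
  \<comment> \<open>The numerator is exactly the slack in the hypothesis on \<open>t\<close>, so
    that hypothesis says the form is semidefinite.\<close>
  have "a * c - b\<^sup>2 = 3 / 8 * (32 - 25 * lam - 9 * lam * t\<^sup>2 - 18 * lam * t) / t"
    using t(1) by (simp add: a_b_c_def field_simps power2_eq_square)
  also have "\<dots> \<ge> 0" using t by simp
  finally have "a * c - b\<^sup>2 \<ge> 0" .
  then have "0 \<le> (a * p + b * q)\<^sup>2 + (a * c - b\<^sup>2) * q\<^sup>2" by simp
  also have "\<dots> = a * (a * p\<^sup>2 + 2 * b * p * q + c * q\<^sup>2)"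
    by (simp add: power2_eq_square algebra_simps)
  finally have form: "0 \<le> a * p\<^sup>2 + 2 * b * p * q + c * q\<^sup>2"
    using a by (simp add: zero_le_mult_iff)
  have "lam * (Re ((5 * P + 3 * R) / 2))\<^sup>2 - Re (4 * P\<^sup>2 + 3 * P * R)
      = lam * ((5 * p + 3 * q) / 2)\<^sup>2 - (4 * (p\<^sup>2 - s\<^sup>2) + 3 * (p * q - s * r))"
    by (simp add: p_s_q_r_def power2_eq_square algebra_simps)
  also have "\<dots> = 4 + 3 / 2 * (2 * (s * r)) + (lam * ((5 * p + 3 * q) / 2)\<^sup>2 - 8 * p\<^sup>2 - 3 * p * q)"
    by (simp add: s2 algebra_simps)
  also have "\<dots> \<le> 4 + 3 / 2 * (t * (1 - p\<^sup>2) + (1 - q\<^sup>2) / t) + (lam * ((5 * p + 3 * q) / 2)\<^sup>2 - 8 * p\<^sup>2 - 3 * p * q)"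
    using sr by (intro add_mono mult_left_mono order_refl) auto
  also have "\<dots> = 4 + 3 / 2 * (t + 1 / t) - (a * p\<^sup>2 + 2 * b * p * q + c * q\<^sup>2)"
    using t(1) by (simp add: a_b_c_def field_simps power2_eq_square)
  finally show ?thesis using form by linarith
qed

text \<open>Hull membership controls only linear functionals. After rotation by \<open>m\<close>,
  the square of Re (m a_4) is therefore replaced by its tangent at the value \<open>u\<close> taken
  by \<open>f\<close>: exact at \<open>f\<close>, and a lower bound at the kernels.\<close>

lemma close_to_convex_functional_bound:
  assumes lam: "lam > 0" and f: "f \<in> close_to_convex" "has_normalized_expansion f a"
    and bound: "\<And>P R. norm P = 1 \<Longrightarrow> norm R = 1 \<Longrightarrow>
      lam * (Re ((5 * P + 3 * R) / 2))\<^sup>2 - Re (4 * P\<^sup>2 + 3 * P * R) \<le> M"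
  shows "norm (of_real lam * (a 4)\<^sup>2 - a 7) \<le> M"
proof -
  define Z where "Z = of_real lam * (a 4)\<^sup>2 - a 7"
  \<comment> \<open>A square root of the rotation is taken because \<open>a 4\<close> enters
    squared: it is multiplied by \<open>m\<close> and \<open>a 7\<close> by
    \<open>m\<^sup>2\<close>.\<close>
  obtain m where m: "norm m = 1" "m\<^sup>2 * Z = of_real (norm Z)"
  proof -
    have "(cis (- Arg Z / 2))\<^sup>2 = cis (- Arg Z)" by (simp add: Complex.DeMoivre)
    moreover have "Z = of_real (norm Z) * cis (Arg Z)"
      by (metis Arg_zero cis_zero mult_zero_left norm_zero of_real_0 rcis_cmod_Arg rcis_def)
    then have "cis (- Arg Z) * Z = of_real (norm Z)"
      by (metis cis_mult cis_zero add.left_inverse mult.left_commute mult.right_neutral mult.commute)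
    ultimately show ?thesis using that[of "cis (- Arg Z / 2)"] by simp
  qed
  define u where "u = Re (m * a 4)"
  define F where "F = Abs_fps (\<lambda>n. if n = 0 then 0 else if n = 1 then 1 else a n)"
  have F: "f has_fps_expansion F"
    unfolding F_def by (rule normalized_expansion_has_fps_expansion[OF f(2)])
  \<comment> \<open>The hull contains f', whose n-th coefficient is (n + 1) a_(n+1); this explains
    the indices 3 and 6 and the divisors 4 and 7.\<close>
  define c where "c = (\<lambda>n::nat. if n = 3 then of_real (2 * lam * u) * m / 4 else if n = 6 then - m\<^sup>2 / 7 else 0)"
  have c: "(\<Sum>n\<le>6. c n * G $ n) = of_real (2 * lam * u) * m / 4 * G $ 3 - m\<^sup>2 / 7 * G $ 6" for G :: "complex fps"
    by (simp add: c_def numeral_eq_Suc)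
  have "Re (\<Sum>n\<le>6. c n * fps_deriv F $ n) \<le> M + lam * u\<^sup>2"
  proof (rule fps_hullD[OF close_to_convex_deriv_in_hull[OF f(1) F]])
    fix G assume "G \<in> {(1 - fps_const x * fps_X) * geo y ^ 3 | x y. norm x = 1 \<and> norm y = 1}"
    then obtain x y where G: "G = (1 - fps_const x * fps_X) * geo y ^ 3" and xy: "norm x = 1" "norm y = 1" by blast
    have geo3: "(geo y ^ 3) $ 2 = 6 * y ^ 2" "(geo y ^ 3) $ 3 = 10 * y ^ 3"
      "(geo y ^ 3) $ 5 = 21 * y ^ 5" "(geo y ^ 3) $ 6 = 28 * y ^ 6"
      by (simp_all add: geo_def power3_eq_cube fps_mult_nth numeral_eq_Suc algebra_simps)
    define P R where "P = m * y ^ 3" "R = - m * x * y ^ 2"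
    have PR: "norm P = 1" "norm R = 1" using m xy by (simp_all add: P_R_def norm_mult norm_power)
    have G3: "G $ 3 = 10 * y ^ 3 - x * (6 * y ^ 2)" and G6: "G $ 6 = 28 * y ^ 6 - x * (21 * y ^ 5)"
      by (simp_all add: G left_diff_distrib mult.assoc geo3)
    have m3: "m / 4 * G $ 3 = (5 * P + 3 * R) / 2"
      unfolding G3 P_R_def by (simp add: field_simps)
    have m6: "m\<^sup>2 / 7 * G $ 6 = 4 * P\<^sup>2 + 3 * P * R"
      unfolding G6 P_R_def by (simp add: field_simps power2_eq_square numeral_eq_Suc)
    define v where "v = Re ((5 * P + 3 * R) / 2)"
    have "Re (\<Sum>n\<le>6. c n * G $ n) = Re (of_real (2 * lam * u) * (m / 4 * G $ 3) - m\<^sup>2 / 7 * G $ 6)"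
      unfolding c by (simp add: mult.assoc)
    also have "\<dots> = 2 * lam * u * v - Re (4 * P\<^sup>2 + 3 * P * R)"
      unfolding m3 m6 v_def by (simp only: minus_complex.sel times_complex.sel(1) Re_complex_of_real Im_complex_of_real mult_zero_left diff_zero)
    \<comment> \<open>the functional is the tangent at \<open>u\<close> to the convex function \<open>lam v\<^sup>2\<close>\<close>
    also have "\<dots> \<le> lam * v\<^sup>2 - Re (4 * P\<^sup>2 + 3 * P * R) + lam * u\<^sup>2"
    proof -
      have "0 \<le> lam * (u - v)\<^sup>2" using lam by simp
      then show ?thesis by (simp add: power2_eq_square algebra_simps)
    qed
    also have "\<dots> \<le> M + lam * u\<^sup>2" using bound[OF PR] by (simp add: v_def)
    finally show "Re (\<Sum>n\<le>6. c n * G $ n) \<le> M + lam * u\<^sup>2" .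
  qed
  also have "(\<Sum>n\<le>6. c n * fps_deriv F $ n) = of_real (2 * lam * u) * (m * a 4) - m\<^sup>2 * a 7"
    unfolding c by (simp add: F_def field_simps)
  finally have lin: "2 * lam * u * u - Re (m\<^sup>2 * a 7) \<le> M + lam * u\<^sup>2"
    by (simp only: minus_complex.sel times_complex.sel Re_complex_of_real Im_complex_of_real u_def mult_zero_left diff_zero)
  have "norm Z = Re (m\<^sup>2 * Z)" by (simp add: m(2))
  also have "m\<^sup>2 * Z = of_real lam * (m * a 4)\<^sup>2 - m\<^sup>2 * a 7"
    by (simp add: Z_def algebra_simps power_mult_distrib)
  also have "Re \<dots> = lam * (u\<^sup>2 - (Im (m * a 4))\<^sup>2) - Re (m\<^sup>2 * a 7)"
    by (simp add: u_def power2_eq_square del: times_complex.sel) (simp add: algebra_simps)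
  \<comment> \<open>The square of the imaginary part enters with a negative sign because
    \<open>lam\<close> is positive.\<close>
  also have "\<dots> \<le> lam * u\<^sup>2 - Re (m\<^sup>2 * a 7)" using lam by (simp add: algebra_simps)
  also have "\<dots> \<le> M" using lin by (simp add: power2_eq_square algebra_simps)
  finally show ?thesis by (simp add: Z_def)
qed

section \<open>Coefficients of the Koebe function and the three ranges of \<open>lam\<close>\<close>

lemma koebe_coeffs:
  assumes "has_normalized_expansion f a" "\<forall>z\<in>unit_disk. f z = koebe z"
  shows "a 4 = 4" "a 7 = 7"
proof -
  define F where "F = Abs_fps (\<lambda>n. if n = 0 then 0 else if n = 1 then 1 else a n)"
  have F: "f has_fps_expansion F"
    unfolding F_def by (rule normalized_expansion_has_fps_expansion[OF assms(1)])
  have "(\<lambda>z. z * (inverse (1 - 1 * z) * inverse (1 - 1 * z))) has_fps_expansion fps_X * (inverse (1 - fps_const 1 * fps_X) * inverse (1 - fps_const (1::complex) * fps_X))"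
    by (intro fps_expansion_intros) auto
  then have "koebe has_fps_expansion fps_X * (geo 1 * geo 1)"
    by (simp add: geo_eq_inverse koebe_def[abs_def] power2_eq_square divide_inverse)
  moreover have "eventually (\<lambda>z. f z = koebe z) (nhds 0)"
    using assms(2) by (intro eventually_mono[OF eventually_nhds_in_open[of "ball 0 1"]]) auto
  ultimately have "f has_fps_expansion fps_X * (geo 1 * geo 1)"
    using has_fps_expansion_cong[OF _ refl] by blast
  with F have eq: "F = fps_X * (geo 1 * geo 1)" by (rule fps_expansion_unique_complex)
  have "a 4 = F $ 4" "a 7 = F $ 7" by (simp_all add: F_def)
  then show "a 4 = 4" "a 7 = 7" by (simp_all add: eq geo_def fps_mult_nth numeral_eq_Suc)
qed

theorem corollary1:
  fixes lam :: real and f :: "complex \<Rightarrow> complex" and a :: "nat \<Rightarrow> complex"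
  assumes "lam > 0"
    and "f \<in> close_to_convex"
    and "has_normalized_expansion f a"
  shows "(lam \<ge> 1 \<longrightarrow>
            norm (of_real lam * (a 4)\<^sup>2 - a 7) \<le> 16 * lam - 7 \<and>
            ((\<forall>z\<in>unit_disk. f z = koebe z) \<longrightarrow>
               norm (of_real lam * (a 4)\<^sup>2 - a 7) = 16 * lam - 7)) \<and>
         (8 / 13 < lam \<and> lam < 1 \<longrightarrow>
            norm (of_real lam * (a 4)\<^sup>2 - a 7)
              \<le> (lam * (80 - 49 * lam) + 32 * (2 - lam) * sqrt (lam * (2 - lam)))
                 / (lam * (32 - 25 * lam))) \<and>
         (lam \<le> 8 / 13 \<longrightarrow>
            norm (of_real lam * (a 4)\<^sup>2 - a 7) \<le> 7)"
proof (intro conjI impI)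
  note main = close_to_convex_functional_bound[OF assms]
  show "norm (of_real lam * (a 4)\<^sup>2 - a 7) \<le> 16 * lam - 7" if "lam \<ge> 1"
  proof (rule main)
    fix P R :: complex assume PR: "norm P = 1" "norm R = 1"
    let ?v = "Re ((5 * P + 3 * R) / 2)"
    \<comment> \<open>At \<open>lam = 1\<close> the condition on t reads 9 t^2 + 18 t <= 7, with
      equality at t = 1/3. The excess (lam - 1) v^2 is bounded separately by |v| <= (5 + 3) / 2 =
      4.\<close>
    have "1 * ?v\<^sup>2 - Re (4 * P\<^sup>2 + 3 * P * R) \<le> 4 + 3 / 2 * (1 / 3 + 1 / (1 / 3))"
      by (rule extreme_point_bound) (use PR in \<open>auto simp: power2_eq_square\<close>)
    then have "?v\<^sup>2 - Re (4 * P\<^sup>2 + 3 * P * R) \<le> 9" by (simp only: mult_1) simp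
    moreover have "\<bar>?v\<bar> \<le> 4"
    proof -
      have "\<bar>?v\<bar> \<le> norm ((5 * P + 3 * R) / 2)" by (rule abs_Re_le_cmod)
      also have "\<dots> \<le> 4" using norm_triangle_ineq[of "5 * P" "3 * R"] PR by (simp add: norm_divide norm_mult)
      finally show ?thesis .
    qed
    then have "?v\<^sup>2 \<le> 4\<^sup>2" by (rule power2_le_iff_abs_le[THEN iffD2, rotated]) simp
    then have "(lam - 1) * ?v\<^sup>2 \<le> (lam - 1) * 16" using that by (intro mult_left_mono) auto
    ultimately show "lam * ?v\<^sup>2 - Re (4 * P\<^sup>2 + 3 * P * R) \<le> 16 * lam - 7"
      unfolding left_diff_distrib by linarith
  qed
  show "norm (of_real lam * (a 4)\<^sup>2 - a 7) = 16 * lam - 7" if "lam \<ge> 1" "\<forall>z\<in>unit_disk. f z = koebe z"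
  proof -
    have "of_real lam * (a 4)\<^sup>2 - a 7 = of_real (16 * lam - 7)"
      using koebe_coeffs[OF assms(3) that(2)] by simp
    then show ?thesis using that(1) by (simp only: norm_of_real)
  qed
  show "norm (of_real lam * (a 4)\<^sup>2 - a 7)
      \<le> (lam * (80 - 49 * lam) + 32 * (2 - lam) * sqrt (lam * (2 - lam))) / (lam * (32 - 25 * lam))"
    if lam': "8 / 13 < lam \<and> lam < 1"
  proof (rule main)
    fix P R :: complex assume PR: "norm P = 1" "norm R = 1"
    define w where "w = sqrt (lam * (2 - lam))"
    have w2: "w\<^sup>2 = lam * (2 - lam)" using assms(1) lam' by (simp add: w_def)
    have "lam * lam < lam * (2 - lam)" using assms(1) lam' by (intro mult_strict_left_mono) auto
    then have w: "w > lam" unfolding w_def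
      by (intro real_less_rsqrt) (simp add: power2_eq_square)
    \<comment> \<open>the positive root of \<open>9 lam t^2 + 18 lam t = 32 - 25 lam\<close>\<close>
    define t where "t = (4 * w - 3 * lam) / (3 * lam)"
    have t0: "t > 0" using w assms(1) by (simp add: t_def)
    have root: "9 * lam * t\<^sup>2 + 18 * lam * t = 32 - 25 * lam"
    proof -
      have "lam * (9 * lam * t\<^sup>2 + 18 * lam * t) = 16 * w\<^sup>2 - 9 * lam\<^sup>2"
        using assms(1) by (simp add: t_def field_simps power2_eq_square)
      also have "\<dots> = lam * (32 - 25 * lam)" unfolding w2 by (simp add: power2_eq_square algebra_simps)
      finally show ?thesis using assms(1) by simp
    qed
    \<comment> \<open>Rationalization by the conjugate 4 w + 3 lam, using 16 w^2 - 9 lam^2 = lam (32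
      - 25 lam).\<close>
    have "1 / t = 3 * (4 * w + 3 * lam) / (32 - 25 * lam)"
    proof -
      have "t * (3 * (4 * w + 3 * lam)) * lam = 16 * w\<^sup>2 - 9 * lam\<^sup>2"
        using assms(1) by (simp add: t_def field_simps power2_eq_square)
      also have "\<dots> = (32 - 25 * lam) * lam" unfolding w2 by (simp add: power2_eq_square algebra_simps)
      finally have "t * (3 * (4 * w + 3 * lam)) = 32 - 25 * lam" using assms(1) by (simp only: mult_cancel_right) simp
      then show ?thesis using t0 lam' by (simp add: field_simps)
    qed
    then have "4 + 3 / 2 * (t + 1 / t) = (lam * (80 - 49 * lam) + 32 * (2 - lam) * w) / (lam * (32 - 25 * lam))"
      unfolding \<open>1 / t = _\<close> using assms(1) lam' by (simp add: t_def field_simps)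
    with extreme_point_bound[OF assms(1) _ t0 eq_refl[OF root] PR] lam'
    show "lam * (Re ((5 * P + 3 * R) / 2))\<^sup>2 - Re (4 * P\<^sup>2 + 3 * P * R)
       \<le> (lam * (80 - 49 * lam) + 32 * (2 - lam) * sqrt (lam * (2 - lam))) / (lam * (32 - 25 * lam))"
      by (simp only: w_def) simp
  qed
  show "norm (of_real lam * (a 4)\<^sup>2 - a 7) \<le> 7" if "lam \<le> 8 / 13"
  proof (rule main)
    fix P R :: complex assume PR: "norm P = 1" "norm R = 1"
    \<comment> \<open>The weight t = 1 minimizes t + 1/t; it is admissible when 27 lam <= 32 - 25
      lam, that is, for lam <= 8/13.\<close>
    have "lam * (Re ((5 * P + 3 * R) / 2))\<^sup>2 - Re (4 * P\<^sup>2 + 3 * P * R) \<le> 4 + 3 / 2 * (1 + 1 / 1)"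
      by (rule extreme_point_bound) (use PR that assms(1) in auto)
    then show "lam * (Re ((5 * P + 3 * R) / 2))\<^sup>2 - Re (4 * P\<^sup>2 + 3 * P * R) \<le> 7" by simp
  qed
qed

end
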